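(* Let $G$ be a closed subgroup of $GL(\mathbb{R}^2)$. Then $G$ has Liouville property on the projective line $\mathbb{P}^1 = \mathbb{P}(\mathbb{R}^2)$ (for the projective linear action).
   Context: Probability measures on a locally compact group $G$ are regular Borel probability measures. For such a measure $\mu$, $G_\mu$ (resp. $S_\mu$) denotes the closed subgroup (resp. closed subsemigroup) of $G$ generated by the support of $\mu$; $\mu$ is called irreducible if $S_\mu = G$. A $G$-space $E$ is a locally compact space with a continuous $G$-action. A bounded measurable function $f$ on $E$ is called $\mu$-harmonic if $\int f(gx)\,d\mu(g) = f(x)$ for all $x\in E$. The measure $\mu$ has Liouville property on $E$ if every continuous bounded $\mu$-harmonic function on $E$ is $G_\mu$-invariant. The group $G$ has Liouville property on $E$ if every irreducible probability measure on $G$ has Liouville property on $E$. For a vector space $V$, $\mathbb{P}(V)$ denotes the corresponding projective space (the space of one-dimensional subspaces of $V$). *)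

theory Defs
  imports "HOL-Analysis.Analysis" "HOL-Probability.Probability_Measure" "HOL-Algebra.Group"
begin

text \<open>
  A topological group is given by a group \<open>G\<close> together with a topology \<open>T\<close> whose
  \<open>topspace\<close> is \<open>carrier G\<close>; a \<open>G\<close>-space is given by a topology \<open>E\<close> and an action
  \<open>act\<close> of \<open>carrier G\<close> on \<open>topspace E\<close>. Values outside the carriers are irrelevant.
\<close>

definition borel_on :: "'a topology \<Rightarrow> 'a measure" where
  "borel_on T = sigma (topspace T) {U. openin T U}"

definition regular_borel_prob :: "'a topology \<Rightarrow> 'a measure \<Rightarrow> bool" where
  "regular_borel_prob T \<mu> \<longleftrightarrow>
     prob_space \<mu> \<and> sets \<mu> = sets (borel_on T) \<and>
     (\<forall>B\<in>sets \<mu>. emeasure \<mu> B = (INF U\<in>{U. openin T U \<and> B \<subseteq> U}. emeasure \<mu> U)) \<and>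
     (\<forall>B\<in>sets \<mu>. emeasure \<mu> B =
        (SUP K\<in>{K. compactin T K \<and> K \<in> sets \<mu> \<and> K \<subseteq> B}. emeasure \<mu> K))"

definition measure_support :: "'a topology \<Rightarrow> 'a measure \<Rightarrow> 'a set" where
  "measure_support T \<mu> =
     {x \<in> topspace T. \<forall>U. openin T U \<and> x \<in> U \<longrightarrow> emeasure \<mu> U > 0}"

definition closed_subgroup_gen :: "('g, 'm) monoid_scheme \<Rightarrow> 'g topology \<Rightarrow> 'g set \<Rightarrow> 'g set" where
  "closed_subgroup_gen G T A = \<Inter>{H. subgroup H G \<and> closedin T H \<and> A \<subseteq> H}"

definition closed_subsemigroup_gen :: "('g, 'm) monoid_scheme \<Rightarrow> 'g topology \<Rightarrow> 'g set \<Rightarrow> 'g set" where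
  "closed_subsemigroup_gen G T A =
     \<Inter>{S. S \<subseteq> carrier G \<and> (\<forall>x\<in>S. \<forall>y\<in>S. x \<otimes>\<^bsub>G\<^esub> y \<in> S) \<and> closedin T S \<and> A \<subseteq> S}"

definition irreducible_measure :: "('g, 'm) monoid_scheme \<Rightarrow> 'g topology \<Rightarrow> 'g measure \<Rightarrow> bool" where
  "irreducible_measure G T \<mu> \<longleftrightarrow>
     closed_subsemigroup_gen G T (measure_support T \<mu>) = carrier G"

definition harmonic_on ::
    "'g measure \<Rightarrow> 'e topology \<Rightarrow> ('g \<Rightarrow> 'e \<Rightarrow> 'e) \<Rightarrow> ('e \<Rightarrow> real) \<Rightarrow> bool" where
  "harmonic_on \<mu> E act f \<longleftrightarrow>
     bounded (f ` topspace E) \<and> f \<in> borel_measurable (borel_on E) \<and>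
     (\<forall>x\<in>topspace E. (\<integral>g. f (act g x) \<partial>\<mu>) = f x)"

definition measure_Liouville ::
    "('g, 'm) monoid_scheme \<Rightarrow> 'g topology \<Rightarrow> 'g measure \<Rightarrow> 'e topology \<Rightarrow> ('g \<Rightarrow> 'e \<Rightarrow> 'e) \<Rightarrow> bool" where
  "measure_Liouville G T \<mu> E act \<longleftrightarrow>
     (\<forall>f. continuous_map E euclideanreal f \<and> bounded (f ` topspace E) \<and> harmonic_on \<mu> E act f \<longrightarrow>
        (\<forall>g\<in>closed_subgroup_gen G T (measure_support T \<mu>). \<forall>x\<in>topspace E. f (act g x) = f x))"

definition group_Liouville ::
    "('g, 'm) monoid_scheme \<Rightarrow> 'g topology \<Rightarrow> 'e topology \<Rightarrow> ('g \<Rightarrow> 'e \<Rightarrow> 'e) \<Rightarrow> bool" where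
  "group_Liouville G T E act \<longleftrightarrow>
     (\<forall>\<mu>. regular_borel_prob T \<mu> \<and> irreducible_measure G T \<mu> \<longrightarrow> measure_Liouville G T \<mu> E act)"

definition GL :: "(real^'n^'n) monoid" where
  "GL = \<lparr>carrier = {A. invertible A}, monoid.mult = (**), one = mat 1\<rparr>"

definition proj_lines :: "'a::euclidean_space set set" where
  "proj_lines = {L. subspace L \<and> dim L = 1}"

text \<open>The quotient topology under \<open>v \<mapsto> span {v}\<close> from the (open) set of nonzero vectors.\<close>

definition proj_space :: "'a::euclidean_space set topology" where
  "proj_space = topology (\<lambda>U. U \<subseteq> proj_lines \<and> open {v. v \<noteq> 0 \<and> span {v} \<in> U})"

definition proj_act :: "real^'n^'n \<Rightarrow> (real^'n) set \<Rightarrow> (real^'n) set" where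
  "proj_act A L = (\<lambda>v. A *v v) ` L"

lemma group_GL: "group (GL :: (real^'n^'n) monoid)"
proof (rule groupI)
  fix A :: "real^'n^'n" assume "A \<in> carrier GL"
  then show "\<exists>B\<in>carrier GL. B \<otimes>\<^bsub>GL\<^esub> A = \<one>\<^bsub>GL\<^esub>"
    by (auto simp: GL_def invertible_def)
qed (auto simp: GL_def invertible_mult matrix_mul_assoc invertible_def[of "mat 1"] intro: exI[of _ "mat 1"])

lemma span_in_proj_lines: "v \<noteq> 0 \<Longrightarrow> span {v} \<in> proj_lines"
  by (simp add: proj_lines_def dim_span)

lemma istopology_proj:
  "istopology (\<lambda>U :: 'a::euclidean_space set set. U \<subseteq> proj_lines \<and> open {v. v \<noteq> 0 \<and> span {v} \<in> U})"
proof -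
  have "{v. v \<noteq> 0 \<and> span {v} \<in> S \<inter> T} = {v. v \<noteq> 0 \<and> span {v} \<in> S} \<inter> {v. v \<noteq> 0 \<and> span {v} \<in> T}"
    for S T :: "'a set set" by auto
  moreover have "{v. v \<noteq> 0 \<and> span {v} \<in> \<Union>K} = (\<Union>S\<in>K. {v. v \<noteq> 0 \<and> span {v} \<in> S})"
    for K :: "'a set set set" by auto
  ultimately show ?thesis
    unfolding istopology_def by (auto simp: open_Int)
qed

lemma openin_proj_space:
  "openin proj_space U \<longleftrightarrow> U \<subseteq> proj_lines \<and> open {v. v \<noteq> 0 \<and> span {v} \<in> U}"
  unfolding proj_space_def by (simp add: topology_inverse'[OF istopology_proj])

lemma topspace_proj_space: "topspace (proj_space :: 'a::euclidean_space set topology) = proj_lines"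
proof -
  have "{v::'a. v \<noteq> 0 \<and> span {v} \<in> proj_lines} = - {0}"
    using span_in_proj_lines by auto
  then have "openin proj_space (proj_lines :: 'a set set)"
    by (simp add: openin_proj_space open_Compl)
  then show ?thesis
    by (metis openin_proj_space openin_subset openin_topspace subset_antisym)
qed

lemma proj_act_in_proj_lines:
  fixes A :: "real^'n^'n"
  assumes "A \<in> carrier GL" "L \<in> proj_lines"
  shows "proj_act A L \<in> proj_lines"
proof -
  have "inj ((*v) A)"
    using assms(1) by (simp add: GL_def inj_matrix_vector_mult)
  then show ?thesis
    using assms(2) unfolding proj_act_def proj_lines_def
    by (simp add: dim_image_eq inj_on_subset linear_subspace_image)
qed

end

theory Submission
  imports Defs
begin

text \<open>
  A continuous function \<open>f\<close> on the projective line lifts to a function \<open>F\<close> on the nonzero vectors that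
  is homogeneous of degree 0, and invariance of \<open>F\<close> under the group \<open>H\<close> is what has to be shown. The
  basic tool is the maximum principle (\<open>maximum_principle\<close>): where \<open>F\<close> attains its maximum over an
  \<open>H\<close>-invariant set, the average of \<open>F (g *v v)\<close> over \<open>g\<close> equals an upper bound of these values, so
  they are equal to it for \<open>g\<close> in the support of the measure. The \<open>g\<close> that preserve the set of maximum
  points form a closed semigroup; by irreducibility, they make up all of \<open>H\<close>.

  Let \<open>K\<close> be the closure of the set of real multiples of elements of \<open>H\<close>. If \<open>F\<close> is constant along the
  orbit of \<open>v\<close> then \<open>F (B *v v) = F v\<close> for all \<open>B \<in> K\<close> with \<open>B *v v \<noteq> 0\<close>. In dimension two \<open>K\<close> is closed
  under the adjugate, which replaces the inverse also for singular limits. Two cases arise.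

  If all nonzero elements of \<open>K\<close> are invertible (the image of \<open>H\<close> in the projective group is then
  relatively compact), \<open>F\<close> attains a maximum on the projectively compact set of all \<open>B *v x\<close>,
  \<open>0 \<noteq> B \<in> K\<close>. The adjugate leads from the maximum point back to \<open>x\<close>, so that \<open>x\<close> is itself a maximum
  point and \<open>F\<close> is constant on its orbit (\<open>nonsingular_cone_invariant\<close>).

  Otherwise \<open>K\<close> contains a singular \<open>B \<noteq> 0\<close>, with kernel spanned by \<open>p\<close> and image spanned by \<open>q\<close>.
  Then \<open>B\<close> sends every vector outside its kernel to the line of \<open>q\<close>, and its adjugate sends every
  vector outside the line of \<open>q\<close> to the line of \<open>p\<close>. Applied to the points where \<open>F\<close> is extremal, this
  shows that a nonconstant \<open>F\<close> takes its maximum on one of the two lines and its minimum on the other,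
  and nowhere else. So \<open>H\<close> fixes two distinct lines, is simultaneously diagonalizable and hence
  commutative (\<open>singular_limit_commutative\<close>). For commutative \<open>H\<close> the theorem is an instance of the
  Choquet-Deny theorem (\<open>commutative_invariant\<close>): the function \<open>F (g *v v) - F v\<close> of \<open>v\<close> is again
  harmonic, and if its maximum were positive, \<open>F\<close> would grow linearly along the powers of \<open>g\<close>.
\<close>

section \<open>Matrices acting on lines\<close>

lemma matrix_scaleR_mult: "(c *\<^sub>R A) ** B = c *\<^sub>R (A ** B)"
  and matrix_mult_scaleR: "A ** (c *\<^sub>R B) = c *\<^sub>R (A ** B)" for A B :: "real^'n^'n"
  by (simp_all add: vec_eq_iff matrix_matrix_mult_def sum_distrib_left mult_ac)

lemma invertible_mult_vec_nonzero:
  fixes A :: "real^'n^'n"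
  assumes "invertible A" "v \<noteq> 0"
  shows "A *v v \<noteq> 0"
  using assms by (metis invertible_def matrix_vector_mul_assoc matrix_vector_mul_lid matrix_vector_mult_0_right)

lemma proj_act_span: "proj_act A (span {v}) = span {A *v v}"
  unfolding proj_act_def by (simp add: linear_span_image[symmetric])

section \<open>Harmonic functions of degree zero and the maximum principle\<close>

text \<open>
  The lift to nonzero vectors of a continuous harmonic function on a projective space. The value
  \<open>F 0\<close> is arbitrary. Bundling the hypotheses makes it possible to apply every result to \<open>- F\<close> and
  to the differences \<open>F (g *v v) - F v\<close> as well.
\<close>

locale harmonic_function =
  fixes H :: "(real^'n^'n) set" and \<mu> :: "(real^'n^'n) measure" and F :: "real^'n \<Rightarrow> real"
  assumes subgroup: "subgroup H GL"
    and prob: "prob_space \<mu>"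
    and sets_eq: "sets \<mu> = sets (borel_on (top_of_set H))"
    and irreducible: "irreducible_measure (GL\<lparr>carrier := H\<rparr>) (top_of_set H) \<mu>"
    and cont: "continuous_on (- {0}) F"
    and homogeneous: "c \<noteq> 0 \<Longrightarrow> F (c *\<^sub>R v) = F v"
    and harmonic: "v \<noteq> 0 \<Longrightarrow> (\<integral>g. F (g *v v) \<partial>\<mu>) = F v"
begin

lemma invertible_mem: "g \<in> H \<Longrightarrow> invertible g"
  using subgroup.subset[OF subgroup] by (auto simp: GL_def)

lemma one_mem: "mat 1 \<in> H"
  using subgroup.one_closed[OF subgroup] by (simp add: GL_def)

lemma mult_mem: "g \<in> H \<Longrightarrow> h \<in> H \<Longrightarrow> g ** h \<in> H"
  using subgroup.m_closed[OF subgroup] by (simp add: GL_def)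

lemma inverse_mem:
  assumes "g \<in> H"
  obtains g' where "g' \<in> H" "g' ** g = mat 1" "g ** g' = mat 1"
proof
  have "g \<in> carrier GL" using assms invertible_mem by (simp add: GL_def)
  then show "inv\<^bsub>GL\<^esub> g ** g = mat 1" "g ** inv\<^bsub>GL\<^esub> g = mat 1"
    using group.l_inv[OF group_GL] group.r_inv[OF group_GL] by (auto simp: GL_def)
  show "inv\<^bsub>GL\<^esub> g \<in> H" using assms subgroup.m_inv_closed[OF subgroup] by blast
qed

lemma nonzero_mem: "g \<in> H \<Longrightarrow> v \<noteq> 0 \<Longrightarrow> g *v v \<noteq> 0"
  using invertible_mem invertible_mult_vec_nonzero by blast

lemma space_eq: "space \<mu> = H"
  using sets_eq_imp_space_eq[OF sets_eq] by (simp add: borel_on_def space_measure_of_conv)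

lemma open_measurable: "openin (top_of_set H) U \<Longrightarrow> U \<in> sets \<mu>"
  unfolding sets_eq borel_on_def using openin_subset[of "top_of_set H"]
  by (subst sets_measure_of) (auto intro: sigma_sets.Basic)

lemma continuous_orbit:
  assumes "v \<noteq> 0"
  shows "continuous_on H (\<lambda>g. F (g *v v))"
proof (rule continuous_on_compose2[OF cont])
  show "continuous_on H (\<lambda>g. g *v v)"
    unfolding matrix_vector_mult_def by (intro continuous_intros)
qed (use assms nonzero_mem in auto)

text \<open>By homogeneity all values are taken on the unit sphere, which is compact.\<close>

lemma extremes_attained:
  obtains a b where "a \<noteq> 0" "b \<noteq> 0" "\<And>v. v \<noteq> 0 \<Longrightarrow> F b \<le> F v \<and> F v \<le> F a"
proof -
  have c: "continuous_on (sphere 0 1) F"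
    by (rule continuous_on_subset[OF cont]) auto
  have ne: "sphere (0::real^'n) 1 \<noteq> {}" by simp
  obtain a where a: "a \<in> sphere 0 1" "\<forall>v\<in>sphere 0 1. F v \<le> F a"
    using continuous_attains_sup[OF compact_sphere ne c] by blast
  obtain b where b: "b \<in> sphere 0 1" "\<forall>v\<in>sphere 0 1. F b \<le> F v"
    using continuous_attains_inf[OF compact_sphere ne c] by blast
  show ?thesis
  proof (rule that[of a b])
    fix v :: "real^'n" assume "v \<noteq> 0"
    then have "F v = F ((1 / norm v) *\<^sub>R v)" and "(1 / norm v) *\<^sub>R v \<in> sphere 0 1"
      by (simp_all add: homogeneous)
    then show "F b \<le> F v \<and> F v \<le> F a" using a b by metis
  qed (use a b in auto)
qed

lemma integrable_orbit:
  assumes "v \<noteq> 0"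
  shows "integrable \<mu> (\<lambda>g. F (g *v v))"
proof -
  interpret prob_space \<mu> by (rule prob)
  obtain a b where ab: "\<And>v. v \<noteq> 0 \<Longrightarrow> F b \<le> F v \<and> F v \<le> F a"
    using extremes_attained by metis
  show ?thesis
  proof (rule integrable_const_bound[where B = "max \<bar>F a\<bar> \<bar>F b\<bar>"])
    show "AE g in \<mu>. norm (F (g *v v)) \<le> max \<bar>F a\<bar> \<bar>F b\<bar>"
      using ab nonzero_mem assms by (intro AE_I2) (fastforce simp: space_eq abs_le_iff max_def)
    show "(\<lambda>g. F (g *v v)) \<in> borel_measurable \<mu>"
    proof (rule borel_measurableI)
      fix S :: "real set" assume "open S"
      then have "openin (top_of_set H) (H \<inter> (\<lambda>g. F (g *v v)) -` S)"
        by (rule continuous_openin_preimage_gen[OF continuous_orbit[OF assms]])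
      then show "(\<lambda>g. F (g *v v)) -` S \<inter> space \<mu> \<in> sets \<mu>"
        by (simp add: space_eq Int_commute open_measurable)
    qed
  qed
qed

text \<open>
  A nonnegative function with integral zero vanishes almost everywhere; as \<open>F v - F (g *v v)\<close> is
  continuous in \<open>g\<close>, it cannot be positive at a point of the support.
\<close>

lemma support_preserves_maximum:
  assumes "v \<noteq> 0" and le: "\<And>g. g \<in> H \<Longrightarrow> F (g *v v) \<le> F v"
    and g: "g \<in> measure_support (top_of_set H) \<mu>"
  shows "F (g *v v) = F v"
proof (rule ccontr)
  interpret prob_space \<mu> by (rule prob)
  have gH: "g \<in> H" using g by (simp add: measure_support_def)
  assume "F (g *v v) \<noteq> F v"
  then have less: "F (g *v v) < F v" using le[OF gH] by simp
  let ?U = "H \<inter> (\<lambda>g. F (g *v v)) -` {..<F v}"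
  have U: "openin (top_of_set H) ?U"
    by (rule continuous_openin_preimage_gen[OF continuous_orbit[OF assms(1)]]) simp
  have pos: "emeasure \<mu> ?U > 0"
    using g U less gH by (auto simp: measure_support_def)
  have int: "integrable \<mu> (\<lambda>g. F v - F (g *v v))"
    using integrable_orbit[OF assms(1)] by simp
  have "(\<integral>g. F v - F (g *v v) \<partial>\<mu>) = 0"
    using integrable_orbit[OF assms(1)] harmonic[OF assms(1)] by (simp add: prob_space)
  then have "AE g in \<mu>. F v - F (g *v v) = 0"
    by (subst (asm) integral_nonneg_eq_0_iff_AE[OF int]) (auto intro!: AE_I2 le simp: space_eq)
  then have "AE g in \<mu>. g \<notin> ?U" by (rule AE_mp) (auto intro!: AE_I2)
  then have "emeasure \<mu> ?U = 0"
    using AE_iff_measurable[of ?U \<mu> "\<lambda>g. g \<notin> ?U"] open_measurable[OF U] by (auto simp: space_eq)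
  then show False using pos by simp
qed

text \<open>
  The set \<open>C\<close> is kept general because the maximum is taken both over all nonzero vectors and over the
  limit set of a single orbit. Although the conclusion concerns one maximum point \<open>v\<close>, the semigroup
  \<open>S\<close> in the proof must preserve the set of all maximum points, since for a product
  \<open>x ** y\<close> the element \<open>x\<close> acts at \<open>y *v w\<close>.
\<close>

lemma maximum_principle:
  assumes C: "0 \<notin> C" "\<And>g v. g \<in> H \<Longrightarrow> v \<in> C \<Longrightarrow> g *v v \<in> C"
    and max: "v \<in> C" "\<And>w. w \<in> C \<Longrightarrow> F w \<le> F v"
    and "g \<in> H"
  shows "F (g *v v) = F v"
proof -
  define X where "X = {w \<in> C. F w = F v}"
  define S where "S = {g \<in> H. \<forall>w\<in>X. g *v w \<in> X}"
  have S_eq: "S = H \<inter> (\<Inter>w\<in>X. {g \<in> H. F (g *v w) = F v})"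
    using C by (auto simp: S_def X_def)
  have nz: "w \<noteq> 0" if "w \<in> X" for w using that C by (auto simp: X_def)
  have "closedin (top_of_set H) S"
  proof (cases "X = {}")
    case True
    then show ?thesis by (simp add: S_eq)
  next
    case False
    have "closedin (top_of_set H) {g \<in> H. F (g *v w) = F v}" if "w \<in> X" for w
      using continuous_closedin_preimage_constant[OF continuous_orbit[OF nz[OF that]], of "F v"]
      by simp
    then show ?thesis unfolding S_eq using False
      by (intro closedin_Int closedin_Inter) auto
  qed
  moreover have "x ** y \<in> S" if "x \<in> S" "y \<in> S" for x y
    using that by (auto simp: S_def mult_mem simp flip: matrix_vector_mul_assoc)
  moreover have "measure_support (top_of_set H) \<mu> \<subseteq> S"
  proof
    fix h assume h: "h \<in> measure_support (top_of_set H) \<mu>"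
    then have "h \<in> H" by (simp add: measure_support_def)
    moreover have "h *v w \<in> X" if w: "w \<in> X" for w
    proof -
      have "F (h *v w) = F w"
        using w C max nz by (intro support_preserves_maximum[OF _ _ h]) (auto simp: X_def)
      then show ?thesis using w C \<open>h \<in> H\<close> by (auto simp: X_def)
    qed
    ultimately show "h \<in> S" by (simp add: S_def)
  qed
  ultimately have "closed_subsemigroup_gen (GL\<lparr>carrier := H\<rparr>) (top_of_set H)
      (measure_support (top_of_set H) \<mu>) \<subseteq> S"
    unfolding closed_subsemigroup_gen_def by (intro Inter_lower) (auto simp: GL_def S_def)
  then have "H \<subseteq> S" using irreducible by (simp add: irreducible_measure_def)
  then show ?thesis using assms by (auto simp: S_def X_def)
qed

lemma harmonic_uminus: "harmonic_function H \<mu> (\<lambda>v. - F v)"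
proof (rule harmonic_function.intro)
  show "continuous_on (- {0}) (\<lambda>v. - F v)"
    by (rule continuous_on_minus[OF cont])
qed (simp_all add: subgroup prob sets_eq irreducible harmonic homogeneous)

lemma global_maximum_invariant:
  assumes "v \<noteq> 0" "\<And>w. w \<noteq> 0 \<Longrightarrow> F w \<le> F v" "g \<in> H"
  shows "F (g *v v) = F v"
  by (rule maximum_principle[of "- {0}"]) (use assms nonzero_mem in auto)

lemma global_minimum_invariant:
  assumes "v \<noteq> 0" "\<And>w. w \<noteq> 0 \<Longrightarrow> F v \<le> F w" "g \<in> H"
  shows "F (g *v v) = F v"
  using harmonic_function.global_maximum_invariant[OF harmonic_uminus, of v g] assms by simp

section \<open>The Choquet-Deny argument\<close>

text \<open>
  If \<open>g\<close> commutes with \<open>H\<close> then the translate of \<open>F\<close> by \<open>g\<close> is harmonic: the mean value property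
  at \<open>v\<close> becomes that of \<open>F\<close> at \<open>g *v v\<close>.
\<close>

lemma harmonic_difference:
  assumes comm: "\<And>h. h \<in> H \<Longrightarrow> g ** h = h ** g" and g: "g \<in> H"
  shows "harmonic_function H \<mu> (\<lambda>v. F (g *v v) - F v)"
proof (rule harmonic_function.intro)
  show "continuous_on (- {0}) (\<lambda>v. F (g *v v) - F v)"
  proof (intro continuous_on_diff cont continuous_on_compose2[OF cont])
    show "continuous_on (- {0}) ((*v) g)" by (simp add: linear_continuous_on)
    show "(*v) g ` (- {0}) \<subseteq> - {0}"
      by (rule image_subsetI) (simp add: nonzero_mem[OF g])
  qed
  show "F (g *v (c *\<^sub>R v)) - F (c *\<^sub>R v) = F (g *v v) - F v" if "c \<noteq> 0" for c v
    using that by (simp add: matrix_vector_mult_scaleR homogeneous)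
  fix v :: "real^'n" assume v: "v \<noteq> 0"
  have eq: "F (g *v (h *v v)) = F (h *v (g *v v))" if "h \<in> space \<mu>" for h
    using comm[of h] that by (metis space_eq matrix_vector_mul_assoc)
  have "(\<integral>h. F (g *v (h *v v)) - F (h *v v) \<partial>\<mu>) = (\<integral>h. F (h *v (g *v v)) - F (h *v v) \<partial>\<mu>)"
    by (rule Bochner_Integration.integral_cong[OF refl]) (simp only: eq)
  also have "\<dots> = F (g *v v) - F v"
    using v nonzero_mem[OF g v] by (simp add: integrable_orbit harmonic)
  finally show "(\<integral>h. F (g *v (h *v v)) - F (h *v v) \<partial>\<mu>) = F (g *v v) - F v" .
qed (rule subgroup prob sets_eq irreducible)+

text \<open>
  Let \<open>c\<close> be the maximum of the difference \<open>F (g *v v) - F v\<close>. By the maximum principle, applied to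
  this difference, it has the value \<open>c\<close> along the whole forward orbit of a maximum point under \<open>g\<close>.
  Hence \<open>F\<close> grows by \<open>c\<close> at each step, and \<open>c > 0\<close> would contradict boundedness.
\<close>

lemma commuting_le:
  assumes comm: "\<And>h. h \<in> H \<Longrightarrow> g ** h = h ** g" and g: "g \<in> H" and w: "w \<noteq> 0"
  shows "F (g *v w) \<le> F w"
proof -
  interpret D: harmonic_function H \<mu> "\<lambda>v. F (g *v v) - F v"
    by (rule harmonic_difference[OF comm g])
  obtain v where v: "v \<noteq> 0" and vmax: "\<And>w. w \<noteq> 0 \<Longrightarrow> F (g *v w) - F w \<le> F (g *v v) - F v"
    using D.extremes_attained by metis
  define c where "c = F (g *v v) - F v"
  define x where "x n = ((*v) g ^^ n) v" for n
  have x_Suc: "x (Suc n) = g *v x n" for n by (simp add: x_def)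
  have x: "x n \<noteq> 0 \<and> F (g *v x n) - F (x n) = c" for n
  proof (induction n)
    case 0
    show ?case using v by (simp add: x_def c_def)
  next
    case (Suc n)
    then have "x n \<noteq> 0" and c: "F (g *v x n) - F (x n) = c" by blast+
    have "F (g *v (g *v x n)) - F (g *v x n) = F (g *v x n) - F (x n)"
    proof (rule D.global_maximum_invariant[OF \<open>x n \<noteq> 0\<close> _ g])
      fix w :: "real^'n" assume "w \<noteq> 0"
      then show "F (g *v w) - F w \<le> F (g *v x n) - F (x n)"
        unfolding c unfolding c_def by (rule vmax)
    qed
    with c nonzero_mem[OF g \<open>x n \<noteq> 0\<close>] show ?case by (simp add: x_Suc)
  qed
  have sum: "F (x n) = F v + real n * c" for n
  proof (induction n)
    case 0
    show ?case by (simp add: x_def)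
  next
    case (Suc n)
    then show ?case using x[of n] by (simp add: x_Suc algebra_simps)
  qed
  obtain a where a: "\<And>w. w \<noteq> 0 \<Longrightarrow> F w \<le> F a" using extremes_attained by metis
  have "c \<le> 0"
  proof (rule ccontr)
    assume "\<not> c \<le> 0"
    then obtain n where "F a - F v < real n * c" using reals_Archimedean3[of c] by auto
    then show False using a[of "x n"] x[of n] sum[of n] by simp
  qed
  then show ?thesis using vmax[OF w] by (simp add: c_def)
qed

lemma commutative_invariant:
  assumes comm: "\<And>g h. g \<in> H \<Longrightarrow> h \<in> H \<Longrightarrow> g ** h = h ** g" and "g \<in> H" "v \<noteq> 0"
  shows "F (g *v v) = F v"
proof (rule antisym)
  note g = comm[OF \<open>g \<in> H\<close>] \<open>g \<in> H\<close> \<open>v \<noteq> 0\<close>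
  show "F (g *v v) \<le> F v" by (rule commuting_le[OF g])
  have "- F (g *v v) \<le> - F v" by (rule harmonic_function.commuting_le[OF harmonic_uminus g])
  then show "F v \<le> F (g *v v)" by simp
qed

section \<open>Limits of rescaled group elements\<close>

text \<open>
  The closed cone over \<open>H\<close>, which records the limits of \<open>H\<close> in the projective space of matrices,
  including the singular ones.
\<close>

definition cone :: "(real^'n^'n) set" where
  "cone = closure {c *\<^sub>R g |c g. g \<in> H}"

lemma mem_cone:
  assumes "g \<in> H"
  shows "g \<in> cone"
proof -
  have "1 *\<^sub>R g \<in> {c *\<^sub>R g |c g. g \<in> H}" using assms by blast
  then show ?thesis unfolding cone_def scaleR_one by (rule subsetD[OF closure_subset])
qed

lemma closed_cone: "closed cone"
  by (simp add: cone_def)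

lemma cone_image:
  assumes L: "continuous_on UNIV L"
    and mem: "\<And>c g. g \<in> H \<Longrightarrow> \<exists>c' g'. g' \<in> H \<and> L (c *\<^sub>R g) = c' *\<^sub>R g'"
    and B: "B \<in> cone"
  shows "L B \<in> cone"
proof -
  let ?C = "{c *\<^sub>R g |c g. g \<in> H}"
  have "L ` ?C \<subseteq> closure ?C"
  proof (rule image_subsetI)
    fix A assume "A \<in> ?C"
    then obtain c g where g: "g \<in> H" and A: "A = c *\<^sub>R g" by blast
    obtain c' g' where "g' \<in> H" "L (c *\<^sub>R g) = c' *\<^sub>R g'"
      using mem[OF g] by blast
    with A have "L A \<in> ?C" by blast
    then show "L A \<in> closure ?C" by (rule subsetD[OF closure_subset])
  qed
  then have "L ` closure ?C \<subseteq> closure ?C"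
    using image_closure_subset[OF continuous_on_subset[OF L subset_UNIV] closed_closure] by blast
  then show ?thesis using B by (auto simp: cone_def)
qed

lemma cone_mult:
  assumes "g \<in> H" "B \<in> cone"
  shows "g ** B \<in> cone"
proof (rule cone_image[OF _ _ assms(2)])
  show "continuous_on UNIV ((**) g)"
    unfolding matrix_matrix_mult_def by (intro continuous_intros)
  show "\<exists>c' g'. g' \<in> H \<and> g ** (c *\<^sub>R h) = c' *\<^sub>R g'" if "h \<in> H" for c h
    using mult_mem[OF assms(1) that] by (auto simp: matrix_mult_scaleR)
qed

lemma cone_scaleR:
  assumes "B \<in> cone"
  shows "c *\<^sub>R B \<in> cone"
proof (rule cone_image[OF _ _ assms])
  show "continuous_on UNIV ((*\<^sub>R) c :: real^'n^'n \<Rightarrow> _)"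
    by (intro continuous_intros)
  show "\<exists>c' g'. g' \<in> H \<and> c *\<^sub>R d *\<^sub>R g = c' *\<^sub>R g'" if "g \<in> H" for d g
    using that by (metis scaleR_scaleR)
qed

text \<open>
  The vectors \<open>A *v v\<close> are nonzero for \<open>A\<close> near \<open>B\<close>, so \<open>F (A *v v)\<close> is continuous there, and it is equal
  to \<open>F v\<close> whenever \<open>A\<close> is a multiple of an element of \<open>H\<close>.
\<close>

lemma cone_orbit_constant:
  assumes inv: "\<And>g. g \<in> H \<Longrightarrow> F (g *v v) = F v"
    and B: "B \<in> cone" "B *v v \<noteq> 0"
  shows "F (B *v v) = F v"
proof (rule ccontr)
  assume ne: "F (B *v v) \<noteq> F v"
  let ?U = "{A. A *v v \<in> - {0} \<inter> F -` (- {F v})}"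
  have "open (- {0} \<inter> F -` (- {F v}))"
    using cont by (intro continuous_open_preimage) auto
  moreover have "continuous_on UNIV (\<lambda>A::real^'n^'n. A *v v)"
    unfolding matrix_vector_mult_def by (intro continuous_intros)
  ultimately have "open ((\<lambda>A. A *v v) -` (- {0} \<inter> F -` (- {F v})))"
    by (rule open_vimage)
  then have "open ?U" unfolding vimage_def[of "\<lambda>A. A *v v"] .
  moreover have "B \<in> ?U" using ne B by simp
  ultimately obtain c g where "g \<in> H" "c *\<^sub>R g \<in> ?U"
    using B unfolding cone_def closure_iff_nhds_not_empty by blast
  moreover from this have "c \<noteq> 0" by auto
  ultimately show False using inv homogeneous by (auto simp flip: scaleR_matrix_vector_assoc)
qed

end

section \<open>The adjugate of a planar matrix\<close>

text \<open>
  The adjugate matrix. By the Cayley-Hamilton theorem, the trace formula agrees in dimension two with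
  the definition by cofactors; it makes linearity and continuity immediate.
\<close>

definition adj2 :: "real^2^2 \<Rightarrow> real^2^2" where
  "adj2 A = trace A *\<^sub>R mat 1 - A"

lemma adj2_mult: "adj2 A ** A = det A *\<^sub>R mat 1" "A ** adj2 A = det A *\<^sub>R mat 1"
  by (simp_all add: adj2_def vec_eq_iff forall_2 matrix_matrix_mult_def sum_2 det_2 trace_def mat_def
      algebra_simps)

lemma adj2_adj2 [simp]: "adj2 (adj2 A) = A"
  by (simp add: adj2_def vec_eq_iff forall_2 trace_def mat_def sum_2)

lemma adj2_scaleR: "adj2 (c *\<^sub>R A) = c *\<^sub>R adj2 A"
  by (simp add: adj2_def vec_eq_iff forall_2 trace_def mat_def sum_2 algebra_simps)

lemma adj2_eq_0_iff [simp]: "adj2 A = 0 \<longleftrightarrow> A = 0"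
proof -
  have "adj2 0 = 0" by (simp add: adj2_def vec_eq_iff trace_def)
  then show ?thesis by (metis adj2_adj2)
qed

lemma continuous_adj2: "continuous_on S adj2"
  unfolding adj2_def trace_def by (intro continuous_intros)

text \<open>A nonzero row of \<open>A\<close> is orthogonal to both \<open>u\<close> and \<open>v\<close>, so these are proportional.\<close>

lemma kernel_is_line:
  fixes A :: "real^2^2"
  assumes "A \<noteq> 0" "A *v u = 0" "A *v v = 0" "u \<noteq> 0"
  obtains c where "v = c *\<^sub>R u"
proof -
  obtain i where i: "A $ i \<noteq> 0" using assms(1) by (auto simp: vec_eq_iff)
  have eq: "A $ i $ 1 * w $ 1 + A $ i $ 2 * w $ 2 = 0" if "A *v w = 0" for w
    using that by (auto simp: vec_eq_iff matrix_vector_mult_def sum_2)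
  have "u $ 1 * v $ 2 = u $ 2 * v $ 1"
    using eq[OF assms(2)] eq[OF assms(3)] i unfolding vec_eq_iff forall_2 by simp algebra
  moreover have "u $ 1 \<noteq> 0 \<or> u $ 2 \<noteq> 0" using assms(4) by (simp add: vec_eq_iff forall_2)
  ultimately have "v = (v $ 1 / u $ 1) *\<^sub>R u \<or> v = (v $ 2 / u $ 2) *\<^sub>R u"
    by (auto simp: vec_eq_iff forall_2 field_simps)
  then show ?thesis using that by blast
qed

section \<open>Harmonic functions on the projective line\<close>

locale planar_harmonic_function = harmonic_function H \<mu> F
  for H :: "(real^2^2) set" and \<mu> F
begin

text \<open>The adjugate of \<open>g\<close> is the multiple of the inverse of \<open>g\<close> by the determinant.\<close>

lemma adj2_cone:
  assumes "B \<in> cone"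
  shows "adj2 B \<in> cone"
proof (rule cone_image[OF continuous_adj2 _ assms])
  fix c g assume "g \<in> H"
  then obtain g' where g': "g' \<in> H" "g ** g' = mat 1" using inverse_mem by blast
  have "adj2 g = adj2 g ** (g ** g')" by (simp add: g'(2))
  also have "\<dots> = (adj2 g ** g) ** g'" by (rule matrix_mul_assoc)
  also have "\<dots> = det g *\<^sub>R g'" by (simp add: adj2_mult matrix_scaleR_mult)
  finally have "adj2 (c *\<^sub>R g) = (c * det g) *\<^sub>R g'" by (simp add: adj2_scaleR)
  then show "\<exists>c' g'. g' \<in> H \<and> adj2 (c *\<^sub>R g) = c' *\<^sub>R g'" using g' by blast
qed

text \<open>
  The set \<open>C\<close> is the closure of the orbit of \<open>x\<close>, seen in projective space. Since the adjugate of an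
  element of the cone is again in the cone, one gets back from any point of \<open>C\<close> to \<open>x\<close>: this is the
  minimality of orbit closures for a group acting through a relatively compact group.
\<close>

lemma nonsingular_cone_invariant:
  assumes ns: "\<And>B. B \<in> cone \<Longrightarrow> B \<noteq> 0 \<Longrightarrow> det B \<noteq> 0" and "g \<in> H" "x \<noteq> 0"
  shows "F (g *v x) = F x"
proof -
  define C where "C = {B *v x |B. B \<in> cone \<and> B \<noteq> 0}"
  have nz: "B *v x \<noteq> 0" if "B \<in> cone" "B \<noteq> 0" for B
    using invertible_mult_vec_nonzero[OF _ \<open>x \<noteq> 0\<close>] ns[OF that] by (simp add: invertible_det_nz)
  have C0: "0 \<notin> C" using nz by (force simp: C_def)
  have CH: "h *v v \<in> C" if h: "h \<in> H" and v: "v \<in> C" for h v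
  proof -
    obtain B where B: "B \<in> cone" "B \<noteq> 0" "v = B *v x" using v by (auto simp: C_def)
    then have "h *v v = (h ** B) *v x" by (simp add: matrix_vector_mul_assoc)
    moreover have "h ** B \<noteq> 0"
      using nonzero_mem[OF h nz[OF B(1,2)]] by (auto simp: matrix_vector_mul_assoc)
    ultimately show ?thesis using cone_mult[OF h B(1)] by (auto simp: C_def)
  qed
  let ?K = "cone \<inter> sphere 0 1"
  have unit: "(1 / norm B) *\<^sub>R B \<in> ?K" if "B \<in> cone" "B \<noteq> 0" for B
    using that cone_scaleR by simp
  have one: "mat 1 \<in> cone" "mat 1 \<noteq> (0::real^2^2)"
    using mem_cone[OF one_mem] by (simp_all add: vec_eq_iff mat_def exI[of _ 1])
  \<comment> \<open>By homogeneity, the maximum over \<open>C\<close> can be found among the matrices of norm 1.\<close>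
  have "continuous_on ?K (\<lambda>B. F (B *v x))"
  proof (rule continuous_on_compose2[OF cont])
    show "continuous_on ?K (\<lambda>B. B *v x)"
      unfolding matrix_vector_mult_def by (intro continuous_intros)
    show "(\<lambda>B. B *v x) ` ?K \<subseteq> - {0}" using nz by force
  qed
  moreover have "compact ?K" by (simp add: closed_Int_compact closed_cone)
  moreover have "?K \<noteq> {}" using unit[OF one] by blast
  ultimately obtain B where B: "B \<in> ?K" and max: "\<And>A. A \<in> ?K \<Longrightarrow> F (A *v x) \<le> F (B *v x)"
    using continuous_attains_sup[of ?K "\<lambda>B. F (B *v x)"] by blast
  have B0: "B \<noteq> 0" using B by auto
  have maxC: "F w \<le> F (B *v x)" if w: "w \<in> C" for w
  proof -
    obtain A where A: "A \<in> cone" "A \<noteq> 0" "w = A *v x" using w by (auto simp: C_def)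
    have "F w = F (((1 / norm A) *\<^sub>R A) *v x)" using A by (simp add: homogeneous flip: scaleR_matrix_vector_assoc)
    then show ?thesis using max unit A by metis
  qed
  have BC: "B *v x \<in> C" using B B0 by (auto simp: C_def)
  have inv: "F (h *v (B *v x)) = F (B *v x)" if "h \<in> H" for h
    using maximum_principle[OF C0 CH BC maxC that] by blast
  have pull: "adj2 B *v (B *v x) = det B *\<^sub>R x"
    by (simp add: matrix_vector_mul_assoc adj2_mult flip: scaleR_matrix_vector_assoc)
  have detB: "det B \<noteq> 0" using ns B B0 by auto
  have "B \<in> cone" using B by blast
  moreover have "adj2 B *v (B *v x) \<noteq> 0" using pull detB \<open>x \<noteq> 0\<close> by simp
  ultimately have "F (adj2 B *v (B *v x)) = F (B *v x)"
    by (intro cone_orbit_constant[OF inv adj2_cone])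
  then have Fx: "F x = F (B *v x)" using pull detB homogeneous by simp
  have "x \<in> C" unfolding C_def using one by (auto intro!: exI[of _ "mat 1"])
  then show ?thesis using maximum_principle[OF C0 CH _ _ \<open>g \<in> H\<close>, of x] maxC Fx by simp
qed

text \<open>
  Here \<open>F a\<close> and \<open>F b\<close> are the maximum and the minimum of \<open>F\<close>. A vector on which \<open>F\<close> is extremal has
  an orbit on which \<open>F\<close> is constant, and the singular limit \<open>B\<close> and its adjugate carry this value over
  to \<open>q\<close> and \<open>p\<close>, respectively. This forces the two values at \<open>p\<close> and \<open>q\<close> to be the two extremes, so
  that no element of \<open>H\<close> can move the line of \<open>p\<close> or that of \<open>q\<close>.
\<close>

lemma singular_limit_commutative:
  assumes B: "B \<in> cone" "B \<noteq> 0" "det B = 0"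
    and ext: "\<And>v. v \<noteq> 0 \<Longrightarrow> F b \<le> F v \<and> F v \<le> F a" "a \<noteq> 0" "b \<noteq> 0" "F a \<noteq> F b"
    and gh: "g \<in> H" "h \<in> H"
  shows "g ** h = h ** g"
proof -
  let ?B' = "adj2 B"
  have B': "?B' \<in> cone" "?B' \<noteq> 0" using B adj2_cone by auto
  obtain v0 where q0: "B *v v0 \<noteq> 0" using B(2) by (metis matrix_eq matrix_vector_mult_0)
  obtain w0 where p0: "?B' *v w0 \<noteq> 0" using B'(2) by (metis matrix_eq matrix_vector_mult_0)
  define q where "q = B *v v0"
  define p where "p = ?B' *v w0"
  have pq0: "p \<noteq> 0" "q \<noteq> 0" using p0 q0 by (auto simp: p_def q_def)
  have BB': "B *v (?B' *v v) = 0" "?B' *v (B *v v) = 0" for v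
    by (simp_all add: matrix_vector_mul_assoc adj2_mult B)
  have ker_B: "\<exists>c. v = c *\<^sub>R p" if "B *v v = 0" for v
    using kernel_is_line[OF B(2) _ that pq0(1)] BB' by (metis p_def)
  have ker_B': "\<exists>c. v = c *\<^sub>R q" if "?B' *v v = 0" for v
    using kernel_is_line[OF B'(2) _ that pq0(2)] BB' by (metis q_def)
  have F_line: "F (c *\<^sub>R v) = F v" if "c *\<^sub>R v \<noteq> 0" for c v
    using that homogeneous by auto
  have to_q: "F q = F v" if "\<And>g. g \<in> H \<Longrightarrow> F (g *v v) = F v" "B *v v \<noteq> 0" for v
    using cone_orbit_constant[OF that(1) B(1) that(2)] ker_B'[OF BB'(2)] F_line that(2) by metis
  have to_p: "F p = F v" if "\<And>g. g \<in> H \<Longrightarrow> F (g *v v) = F v" "?B' *v v \<noteq> 0" for v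
    using cone_orbit_constant[OF that(1) B'(1) that(2)] ker_B[OF BB'(1)] F_line that(2) by metis
  have inv: "F (g *v v) = F v" if "v \<noteq> 0" "F v = F a \<or> F v = F b" "g \<in> H" for v g
    using global_maximum_invariant[of v g] global_minimum_invariant[of v g] that ext(1) by auto
  \<comment> \<open>Either \<open>B *v v \<noteq> 0\<close>, and the value at \<open>v\<close> is transported to \<open>q\<close>, or \<open>v\<close> is a multiple of \<open>p\<close>.\<close>
  have val: "F p = F v \<or> F q = F v" if "v \<noteq> 0" "F v = F a \<or> F v = F b" for v
    using to_q[of v] inv[OF that] ker_B[of v] F_line that(1) by metis
  have ext_pq: "F p = F a \<and> F q = F b \<or> F p = F b \<and> F q = F a"
    using val[of a] val[of b] ext by auto
  have eig_p: "\<exists>c. k *v p = c *\<^sub>R p" if "k \<in> H" for k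
  proof (rule ccontr)
    assume "\<not> ?thesis"
    then have "B *v (k *v p) \<noteq> 0" using ker_B by blast
    moreover have "F (k *v p) = F p" using inv pq0 ext_pq that by blast
    ultimately have "F q = F p"
      using to_q[of "k *v p"] inv nonzero_mem[OF that pq0(1)] ext_pq by metis
    then show False using ext_pq ext(4) by auto
  qed
  have eig_q: "\<exists>c. k *v q = c *\<^sub>R q" if "k \<in> H" for k
  proof (rule ccontr)
    assume "\<not> ?thesis"
    then have "?B' *v (k *v q) \<noteq> 0" using ker_B' by blast
    moreover have "F (k *v q) = F q" using inv pq0 ext_pq that by blast
    ultimately have "F p = F q"
      using to_p[of "k *v q"] inv nonzero_mem[OF that pq0(2)] ext_pq by metis
    then show False using ext_pq ext(4) by auto
  qed
  \<comment> \<open>The commutator annihilates the common eigenvectors \<open>p\<close> and \<open>q\<close>, which are not proportional.\<close>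
  have comm: "(g ** h - h ** g) *v u = 0" if u: "\<And>k. k \<in> H \<Longrightarrow> \<exists>c. k *v u = c *\<^sub>R u" for u
  proof -
    obtain c where "g *v u = c *\<^sub>R u" using u gh(1) by blast
    moreover obtain d where "h *v u = d *\<^sub>R u" using u gh(2) by blast
    ultimately show ?thesis
      by (simp add: matrix_vector_mult_diff_rdistrib matrix_vector_mult_scaleR flip: matrix_vector_mul_assoc)
  qed
  show ?thesis
  proof (rule ccontr)
    assume "g ** h \<noteq> h ** g"
    then obtain c where "q = c *\<^sub>R p"
      using kernel_is_line[OF _ comm[OF eig_p] comm[OF eig_q] pq0(1)] by auto
    then have "F q = F p" using F_line pq0 by metis
    then show False using ext_pq ext(4) by auto
  qed
qed

lemma harmonic_invariant:
  assumes "g \<in> H" "v \<noteq> 0"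
  shows "F (g *v v) = F v"
proof -
  obtain a b where ext: "a \<noteq> 0" "b \<noteq> 0" "\<And>v. v \<noteq> 0 \<Longrightarrow> F b \<le> F v \<and> F v \<le> F a"
    using extremes_attained by metis
  consider "F a = F b" | "\<And>B. B \<in> cone \<Longrightarrow> B \<noteq> 0 \<Longrightarrow> det B \<noteq> 0"
    | B where "F a \<noteq> F b" "B \<in> cone" "B \<noteq> 0" "det B = 0" by blast
  then show ?thesis
  proof cases
    case 1
    then show ?thesis using ext(3)[OF assms(2)] ext(3)[OF nonzero_mem[OF assms]] by simp
  next
    case 2
    then show ?thesis using nonsingular_cone_invariant assms by blast
  next
    case 3
    show ?thesis
      by (rule commutative_invariant[OF singular_limit_commutative[OF 3(2-4) ext(3,1,2) 3(1)] assms])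
  qed
qed

end

section \<open>Descent to the projective line\<close>

lemma continuous_lift:
  fixes f :: "('a::euclidean_space) set \<Rightarrow> real"
  assumes "continuous_map proj_space euclideanreal f"
  shows "continuous_on (- {0}) (\<lambda>v. f (span {v}))"
proof (subst continuous_on_open_vimage)
  show "open (- {0::'a})" by (simp add: open_Compl)
  show "\<forall>S. open S \<longrightarrow> open ((\<lambda>v. f (span {v})) -` S \<inter> - {0})"
  proof (intro allI impI)
    fix S :: "real set" assume "open S"
    then have "openin proj_space {L \<in> proj_lines. f L \<in> S}"
      using openin_continuous_map_preimage[OF assms, of S] by (simp add: topspace_proj_space)
    then have "open {v. v \<noteq> 0 \<and> span {v} \<in> {L \<in> proj_lines. f L \<in> S}}"
      by (simp add: openin_proj_space)
    moreover have "{v. v \<noteq> 0 \<and> span {v} \<in> {L \<in> proj_lines. f L \<in> S}}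
        = (\<lambda>v. f (span {v})) -` S \<inter> - {0}"
      using span_in_proj_lines by auto
    ultimately show "open ((\<lambda>v. f (span {v})) -` S \<inter> - {0})" by simp
  qed
qed

lemma proj_lines_span:
  assumes "L \<in> proj_lines"
  obtains v where "v \<noteq> 0" "L = span {v}"
proof -
  obtain B where B: "B \<subseteq> L" "independent B" "L \<subseteq> span B" "card B = dim L"
    using basis_exists by blast
  then obtain v where "B = {v}" using assms by (auto simp: proj_lines_def card_1_singleton_iff)
  then show ?thesis using that[of v] B assms
    by (metis (mono_tags, lifting) dependent_single mem_Collect_eq proj_lines_def span_minimal subset_antisym)
qed

theorem theorem1p2:
  fixes H :: "(real^2^2) set"
  assumes "subgroup H GL" and "closedin (top_of_set (carrier GL)) H"
  shows "group_Liouville (GL\<lparr>carrier := H\<rparr>) (top_of_set H) (proj_space :: (real^2) set topology) proj_act"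
  unfolding group_Liouville_def measure_Liouville_def
proof (intro allI impI ballI, elim conjE)
  fix \<mu> :: "(real^2^2) measure" and f :: "(real^2) set \<Rightarrow> real" and g :: "real^2^2" and L :: "(real^2) set"
  assume reg: "regular_borel_prob (top_of_set H) \<mu>"
    and irr: "irreducible_measure (GL\<lparr>carrier := H\<rparr>) (top_of_set H) \<mu>"
    and f: "continuous_map proj_space euclideanreal f"
    and har: "harmonic_on \<mu> proj_space proj_act f"
    and g: "g \<in> closed_subgroup_gen (GL\<lparr>carrier := H\<rparr>) (top_of_set H) (measure_support (top_of_set H) \<mu>)"
    and L: "L \<in> topspace proj_space"
  have "prob_space \<mu>" and "sets \<mu> = sets (borel_on (top_of_set H))"
    using reg by (simp_all add: regular_borel_prob_def)
  moreover have "f (span {c *\<^sub>R v}) = f (span {v})" if "c \<noteq> 0" for c and v :: "real^2"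
    using span_image_scale[of "{v}" "\<lambda>_. c"] that by simp
  moreover have "(\<integral>g. f (span {g *v v}) \<partial>\<mu>) = f (span {v})" if "v \<noteq> 0" for v :: "real^2"
  proof -
    have "(\<integral>g. f (proj_act g (span {v})) \<partial>\<mu>) = f (span {v})"
      using har span_in_proj_lines[OF that] unfolding harmonic_on_def topspace_proj_space by blast
    then show ?thesis unfolding proj_act_span .
  qed
  ultimately interpret planar_harmonic_function H \<mu> "\<lambda>v. f (span {v})"
    using assms(1) irr continuous_lift[OF f]
    by (intro planar_harmonic_function.intro harmonic_function.intro)
  have "subgroup H (GL\<lparr>carrier := H\<rparr>)"
    using group.subgroup_self[OF subgroup.subgroup_is_group[OF assms(1) group_GL]] by simp
  moreover have "measure_support (top_of_set H) \<mu> \<subseteq> H" by (auto simp: measure_support_def)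
  ultimately have "g \<in> H" using g by (auto simp: closed_subgroup_gen_def)
  moreover obtain v where "v \<noteq> 0" "L = span {v}"
    using L proj_lines_span by (auto simp: topspace_proj_space)
  ultimately show "f (proj_act g L) = f L"
    using harmonic_invariant by (simp add: proj_act_span)
qed

end
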